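(* For any poset $P$ on $[p]$, the sequence $(\Omega_P^e(n))_{n\ge0}$ of values of the enriched order polynomial of $P$ is log-concave, i.e. $\Omega^e_P(n)^2\ge\Omega^e_P(n-1)\,\Omega^e_P(n+1)$ for all $n\ge1$.
   Context: Let $(P,\preceq)$ be a poset whose underlying set is $[p]=\{1,\ldots,p\}$; $<,>$ denote the usual order on integers. Writing $\bar n=-n$, put on the nonzero integers the total order $\bar1\triangleleft1\triangleleft\bar2\triangleleft2\triangleleft\bar3\triangleleft3\triangleleft\cdots$, and let $\langle n\rangle=\{\bar1,1,\bar2,2,\ldots,\bar n,n\}$. An enriched $P$-partition with range $\langle n\rangle$ is a map $f:P\to\langle n\rangle$ such that for all $x\prec y$ in $P$: (E1) $f(x)\trianglelefteq f(y)$; (E2) $f(x)=f(y)>0$ implies $x<y$; (E3) $f(x)=f(y)<0$ implies $x>y$. $\Omega^e_P(n)$ is the number of enriched $P$-partitions with range $\langle n\rangle$. *)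

theory Defs
  imports Main "HOL-Library.FuncSet"
begin

text \<open>
  The order \<open>-1, 1, -2, 2, -3, 3, \<dots>\<close> (from smallest to largest) on the nonzero integers:
  compare absolute values first; for equal absolute values the negative integer comes first.
\<close>

definition enr_le :: "int \<Rightarrow> int \<Rightarrow> bool"  (infix "\<unlhd>\<^sub>e" 50)
  where "a \<unlhd>\<^sub>e b \<longleftrightarrow> \<bar>a\<bar> < \<bar>b\<bar> \<or> (\<bar>a\<bar> = \<bar>b\<bar> \<and> a \<le> b)"

definition enr_range :: "nat \<Rightarrow> int set"
  where "enr_range n = {k. k \<noteq> 0 \<and> \<bar>k\<bar> \<le> int n}"

text \<open>
  A poset on \<open>{1..p}\<close> is given by its reflexive order relation \<open>r\<close>, a set of pairs with
  \<open>partial_order_on {1..p} r\<close>; so \<open>x \<prec> y\<close> is \<open>(x, y) \<in> r \<and> x \<noteq> y\<close>, whereas \<open><\<close> and \<open>>\<close>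
  below compare the labels as integers. Maps are extensional (\<open>undefined\<close> outside
  \<open>{1..p}\<close>), so that each map on \<open>{1..p}\<close> is counted exactly once.
\<close>

definition enriched_P_partitions :: "nat \<Rightarrow> (nat \<times> nat) set \<Rightarrow> nat \<Rightarrow> (nat \<Rightarrow> int) set"
  where "enriched_P_partitions p r n =
    {f \<in> {1..p} \<rightarrow>\<^sub>E enr_range n.
       \<forall>x y. (x, y) \<in> r \<and> x \<noteq> y \<longrightarrow>
         f x \<unlhd>\<^sub>e f y \<and>
         (f x = f y \<and> f y > 0 \<longrightarrow> x < y) \<and>
         (f x = f y \<and> f y < 0 \<longrightarrow> x > y)}"

definition enriched_order_poly :: "nat \<Rightarrow> (nat \<times> nat) set \<Rightarrow> nat \<Rightarrow> nat"
  where "enriched_order_poly p r n = card (enriched_P_partitions p r n)"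

end

theory Submission
  imports Defs
begin

text \<open>
  Log-concavity is an instance of a correlation inequality on a distributive lattice. List the
  nonzero integers along the order \<open>-1, 1, -2, 2, \<dots>\<close> by the ranks \<open>0, 1, 2, 3, \<dots>\<close>: the negative
  values receive the even ranks, and \<open>\<langle>n\<rangle>\<close> becomes \<open>{0..<2n}\<close>. In terms of ranks \<open>a\<close> of \<open>f x\<close> and
  \<open>b\<close> of \<open>f y\<close>, the conditions (E1)--(E3) on a pair \<open>x \<prec> y\<close> say that \<open>a \<le> b\<close>, with equality
  allowed only at one parity, which depends on whether \<open>x < y\<close>. Equivalently \<open>h a \<le> b\<close>, where the
  monotone function \<open>h\<close> moves a rank of the forbidden parity one step up and fixes the others.
  Two features of this description matter:

  \<^item> such inequalities survive pointwise maxima and minima;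
  \<^item> they survive adding \<open>2\<close> to all ranks, because this respects parity.

  By the second point, \<open>\<Omega>(n - 1)\<close> counts the families of ranks in \<open>{2..<2n}\<close>, and \<open>\<Omega>(n)\<close> counts
  those in \<open>{0..<2n}\<close> as well as those in \<open>{2..<2n+2}\<close>. By the first point, if \<open>f\<close> is a family in
  \<open>{2..<2n}\<close> and \<open>g\<close> one in \<open>{0..<2n+2}\<close>, then \<open>max f g\<close> lies in \<open>{2..<2n+2}\<close> and \<open>min f g\<close> in
  \<open>{0..<2n}\<close>. The inequality \<open>|A| |B| \<le> |A \<or> B| |A \<and> B|\<close> for finite subsets of a distributive
  lattice, a case of the four functions theorem of Ahlswede and Daykin
  (\<open>four_functions_theorem\<close>, \<open>card_mult_card_le_max_min\<close>), then gives the result.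
\<close>

section \<open>The four functions theorem\<close>

text \<open>
  The case of a one-element ground set. The diagonal products are bounded directly. For the
  mixed ones \<open>u = a\<^sub>0 b\<^sub>1\<close> and \<open>v = a\<^sub>1 b\<^sub>0\<close>, put \<open>P = c\<^sub>1 d\<^sub>0\<close> and \<open>Q = c\<^sub>0 d\<^sub>1\<close>: both \<open>u\<close> and \<open>v\<close>
  are at most \<open>P\<close>, and \<open>u v \<le> P Q\<close>, so that \<open>(P - u) (P - v) \<ge> 0\<close> yields
  \<open>P (u + v) \<le> P (P + Q)\<close>.
\<close>

lemma four_functions_singleton:
  fixes a\<^sub>0 a\<^sub>1 b\<^sub>0 b\<^sub>1 c\<^sub>0 c\<^sub>1 d\<^sub>0 d\<^sub>1 :: "'a :: linordered_idom"
  assumes nonneg: "a\<^sub>0 \<ge> 0" "a\<^sub>1 \<ge> 0" "b\<^sub>0 \<ge> 0" "b\<^sub>1 \<ge> 0" "c\<^sub>0 \<ge> 0" "c\<^sub>1 \<ge> 0" "d\<^sub>0 \<ge> 0" "d\<^sub>1 \<ge> 0"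
    and "a\<^sub>0 * b\<^sub>0 \<le> c\<^sub>0 * d\<^sub>0" "a\<^sub>0 * b\<^sub>1 \<le> c\<^sub>1 * d\<^sub>0" "a\<^sub>1 * b\<^sub>0 \<le> c\<^sub>1 * d\<^sub>0" "a\<^sub>1 * b\<^sub>1 \<le> c\<^sub>1 * d\<^sub>1"
  shows "(a\<^sub>0 + a\<^sub>1) * (b\<^sub>0 + b\<^sub>1) \<le> (c\<^sub>0 + c\<^sub>1) * (d\<^sub>0 + d\<^sub>1)"
proof -
  define u v P Q where "u = a\<^sub>0 * b\<^sub>1" and "v = a\<^sub>1 * b\<^sub>0" and "P = c\<^sub>1 * d\<^sub>0" and "Q = c\<^sub>0 * d\<^sub>1"
  have uv: "u \<le> P" "v \<le> P" and "P \<ge> 0" "Q \<ge> 0"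
    using assms by (simp_all add: u_def v_def P_def Q_def)
  have "(a\<^sub>0 * b\<^sub>0) * (a\<^sub>1 * b\<^sub>1) \<le> (c\<^sub>0 * d\<^sub>0) * (c\<^sub>1 * d\<^sub>1)"
    by (rule mult_mono) (use assms in simp_all)
  then have "u * v \<le> P * Q"
    by (simp add: u_def v_def P_def Q_def mult_ac)
  moreover have "0 \<le> (P - u) * (P - v)"
    using uv by simp
  ultimately have "P * (u + v) \<le> P * (P + Q)"
    by (simp add: algebra_simps)
  then have "u + v \<le> P + Q"
  proof (cases "P = 0")
    case True
    then show ?thesis using uv \<open>Q \<ge> 0\<close> add_mono[of u 0 v 0] by simp
  next
    case False
    then show ?thesis
      using \<open>P \<ge> 0\<close> \<open>P * (u + v) \<le> P * (P + Q)\<close> by (simp add: mult_le_cancel_left)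
  qed
  then have "(a\<^sub>0 * b\<^sub>0 + a\<^sub>1 * b\<^sub>1) + (u + v) \<le> (c\<^sub>0 * d\<^sub>0 + c\<^sub>1 * d\<^sub>1) + (P + Q)"
    by (intro add_mono[OF add_mono \<open>u + v \<le> P + Q\<close>]) (use assms in simp_all)
  then show ?thesis
    by (simp add: u_def v_def P_def Q_def algebra_simps)
qed

lemma sum_Pow_insert:
  fixes f :: "'b set \<Rightarrow> 'a :: comm_monoid_add"
  assumes "finite S" "x \<notin> S"
  shows "sum f (Pow (insert x S)) = (\<Sum>X\<in>Pow S. f X + f (insert x X))"
proof -
  have "inj_on (insert x) (Pow S)"
    using assms(2) by (auto simp: inj_on_def)
  moreover have "Pow S \<inter> insert x ` Pow S = {}"
    using assms(2) by auto
  ultimately show ?thesis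
    using assms(1) by (simp add: Pow_insert sum.union_disjoint sum.reindex sum.distrib)
qed

text \<open>
  Summing out one element of the ground set preserves the hypothesis, by the one-element case,
  so the number of elements can be reduced to zero.
\<close>

theorem four_functions_theorem:
  fixes \<alpha> \<beta> \<gamma> \<delta> :: "'b set \<Rightarrow> 'a :: linordered_idom"
  assumes "finite S"
    and "\<And>X. X \<subseteq> S \<Longrightarrow> 0 \<le> \<alpha> X" "\<And>X. X \<subseteq> S \<Longrightarrow> 0 \<le> \<beta> X"
    and "\<And>X. X \<subseteq> S \<Longrightarrow> 0 \<le> \<gamma> X" "\<And>X. X \<subseteq> S \<Longrightarrow> 0 \<le> \<delta> X"
    and "\<And>X Y. X \<subseteq> S \<Longrightarrow> Y \<subseteq> S \<Longrightarrow> \<alpha> X * \<beta> Y \<le> \<gamma> (X \<union> Y) * \<delta> (X \<inter> Y)"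
  shows "sum \<alpha> (Pow S) * sum \<beta> (Pow S) \<le> sum \<gamma> (Pow S) * sum \<delta> (Pow S)"
  using assms
proof (induction S arbitrary: \<alpha> \<beta> \<gamma> \<delta> rule: finite_induct)
  case empty
  then show ?case by force
next
  case (insert x S)
  note nonneg = insert.prems(1-4) and four = insert.prems(5)
  show ?case
    unfolding sum_Pow_insert[OF insert.hyps]
  proof (rule insert.IH)
    fix X Y assume XY: "X \<subseteq> S" "Y \<subseteq> S"
    then have "x \<notin> X" "x \<notin> Y" using insert.hyps(2) by auto
    then have inter: "insert x X \<inter> Y = X \<inter> Y" "X \<inter> insert x Y = X \<inter> Y"
      "insert x X \<inter> insert x Y = insert x (X \<inter> Y)" by auto
    have sub: "X \<subseteq> insert x S" "insert x X \<subseteq> insert x S" "Y \<subseteq> insert x S" "insert x Y \<subseteq> insert x S"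
      using XY by auto
    then have sub': "X \<union> Y \<subseteq> insert x S" "insert x (X \<union> Y) \<subseteq> insert x S"
      "X \<inter> Y \<subseteq> insert x S" "insert x (X \<inter> Y) \<subseteq> insert x S" by auto
    show "(\<alpha> X + \<alpha> (insert x X)) * (\<beta> Y + \<beta> (insert x Y))
        \<le> (\<gamma> (X \<union> Y) + \<gamma> (insert x (X \<union> Y))) * (\<delta> (X \<inter> Y) + \<delta> (insert x (X \<inter> Y)))"
      using four[OF sub(1,3)] four[OF sub(1,4)] four[OF sub(2,3)] four[OF sub(2,4)]
      by (intro four_functions_singleton nonneg sub sub') (simp_all add: inter)
  qed (intro add_nonneg_nonneg nonneg; auto)+
qed

text \<open>The theorem for indicator functions of families of sets.\<close>

corollary card_mult_card_le_Un_Int: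
  fixes \<A> \<B> \<C> \<D> :: "'b set set"
  assumes "finite S" "\<A> \<subseteq> Pow S" "\<B> \<subseteq> Pow S" "\<C> \<subseteq> Pow S" "\<D> \<subseteq> Pow S"
    and "\<And>X Y. X \<in> \<A> \<Longrightarrow> Y \<in> \<B> \<Longrightarrow> X \<union> Y \<in> \<C> \<and> X \<inter> Y \<in> \<D>"
  shows "card \<A> * card \<B> \<le> card \<C> * card \<D>"
proof -
  have sum_indicator: "sum (\<lambda>X. of_bool (X \<in> \<F>)) (Pow S) = int (card \<F>)"
    if "\<F> \<subseteq> Pow S" for \<F>
    using that assms(1) by (simp add: Int_absorb1 sum_of_bool_eq Int_def[symmetric])
  have "int (card \<A>) * int (card \<B>) \<le> int (card \<C>) * int (card \<D>)"
    unfolding sum_indicator[OF assms(2), symmetric] sum_indicator[OF assms(3), symmetric]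
      sum_indicator[OF assms(4), symmetric] sum_indicator[OF assms(5), symmetric]
    by (rule four_functions_theorem[OF assms(1)]) (use assms(6) in auto)
  then show ?thesis
    by (simp flip: of_nat_mult)
qed

text \<open>
  A family of natural numbers is determined by the region below its graph. This turns pointwise
  maxima and minima into unions and intersections.
\<close>

theorem card_mult_card_le_max_min:
  fixes A B C D :: "('i \<Rightarrow> nat) set"
  assumes "finite I" "A \<subseteq> I \<rightarrow>\<^sub>E {..m}" "B \<subseteq> I \<rightarrow>\<^sub>E {..m}" "C \<subseteq> I \<rightarrow>\<^sub>E {..m}" "D \<subseteq> I \<rightarrow>\<^sub>E {..m}"
    and closed: "\<And>f g. f \<in> A \<Longrightarrow> g \<in> B \<Longrightarrow>
      (\<lambda>x\<in>I. max (f x) (g x)) \<in> C \<and> (\<lambda>x\<in>I. min (f x) (g x)) \<in> D"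
  shows "card A * card B \<le> card C * card D"
proof -
  define region :: "('i \<Rightarrow> nat) \<Rightarrow> ('i \<times> nat) set" where "region f = Sigma I (\<lambda>x. {..<f x})" for f
  have inj: "inj_on region (I \<rightarrow>\<^sub>E {..m})"
  proof (rule inj_onI)
    fix f g assume fg: "f \<in> I \<rightarrow>\<^sub>E {..m}" "g \<in> I \<rightarrow>\<^sub>E {..m}" "region f = region g"
    show "f = g"
    proof (rule PiE_ext[OF fg(1,2)])
      fix x assume "x \<in> I"
      then have "{..<f x} = {..<g x}" using fg(3) by (auto simp: region_def set_eq_iff)
      then show "f x = g x" by simp
    qed
  qed
  have card: "card (region ` F) = card F" if "F \<subseteq> I \<rightarrow>\<^sub>E {..m}" for F
    using inj_on_subset[OF inj that] by (rule card_image)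
  have sub: "region ` F \<subseteq> Pow (I \<times> {..<m})" if "F \<subseteq> I \<rightarrow>\<^sub>E {..m}" for F
    using that by (fastforce simp: region_def dest: PiE_mem)
  have "region f \<union> region g = region (\<lambda>x\<in>I. max (f x) (g x))"
    "region f \<inter> region g = region (\<lambda>x\<in>I. min (f x) (g x))" for f g
    by (auto simp: region_def)
  then have "X \<union> Y \<in> region ` C \<and> X \<inter> Y \<in> region ` D"
    if "X \<in> region ` A" "Y \<in> region ` B" for X Y
    using that closed by fastforce
  then have "card (region ` A) * card (region ` B) \<le> card (region ` C) * card (region ` D)"
    using assms(1-5) by (intro card_mult_card_le_Un_Int[of "I \<times> {..<m}"] sub) auto
  then show ?thesis
    using assms(2-5) by (simp add: card)
qed

section \<open>Enriched partitions by ranks\<close>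

text \<open>
  Enriched partitions and their descriptions by ranks are both families of values constrained
  on the pairs \<open>x \<prec> y\<close>; only the set \<open>V\<close> of values and the constraint \<open>Q\<close> differ.
\<close>

definition constrained_maps ::
    "'i set \<Rightarrow> ('i \<times> 'i) set \<Rightarrow> ('i \<Rightarrow> 'i \<Rightarrow> 'v \<Rightarrow> 'v \<Rightarrow> bool) \<Rightarrow> 'v set \<Rightarrow> ('i \<Rightarrow> 'v) set"
  where "constrained_maps I r Q V =
    {f \<in> I \<rightarrow>\<^sub>E V. \<forall>x y. (x, y) \<in> r \<and> x \<noteq> y \<longrightarrow> Q x y (f x) (f y)}"

lemma restrict_in_constrained_maps_iff:
  assumes "r \<subseteq> I \<times> I"
  shows "(\<lambda>x\<in>I. f x) \<in> constrained_maps I r Q V \<longleftrightarrow>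
    (\<forall>x\<in>I. f x \<in> V) \<and> (\<forall>x y. (x, y) \<in> r \<and> x \<noteq> y \<longrightarrow> Q x y (f x) (f y))"
proof -
  have "x \<in> I \<and> y \<in> I" if "(x, y) \<in> r" for x y
    using that assms by auto
  then have "(\<forall>x y. (x, y) \<in> r \<and> x \<noteq> y \<longrightarrow> Q x y (restrict f I x) (restrict f I y)) \<longleftrightarrow>
      (\<forall>x y. (x, y) \<in> r \<and> x \<noteq> y \<longrightarrow> Q x y (f x) (f y))"
    by (metis restrict_apply')
  then show ?thesis
    unfolding constrained_maps_def mem_Collect_eq by (simp add: PiE_iff)
qed

text \<open>
  Relabelling the values. This is used twice: to pass from values to ranks, and to shift ranks.
\<close>

lemma card_constrained_maps_cong:
  assumes r: "r \<subseteq> I \<times> I" and \<phi>: "bij_betw \<phi> V W"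
    and Q: "\<And>x y a b. x \<noteq> y \<Longrightarrow> a \<in> V \<Longrightarrow> b \<in> V \<Longrightarrow> R x y (\<phi> a) (\<phi> b) \<longleftrightarrow> Q x y a b"
  shows "card (constrained_maps I r Q V) = card (constrained_maps I r R W)"
proof (rule bij_betw_same_card)
  have mem: "x \<in> I \<and> y \<in> I" if "(x, y) \<in> r" for x y
    using that r by auto
  show "bij_betw (\<lambda>f. \<lambda>x\<in>I. \<phi> (f x)) (constrained_maps I r Q V) (constrained_maps I r R W)"
  proof (rule bij_betw_imageI)
    show "inj_on (\<lambda>f. \<lambda>x\<in>I. \<phi> (f x)) (constrained_maps I r Q V)"
    proof (rule inj_onI)
      fix f g assume "f \<in> constrained_maps I r Q V" "g \<in> constrained_maps I r Q V"
        and eq: "(\<lambda>x\<in>I. \<phi> (f x)) = (\<lambda>x\<in>I. \<phi> (g x))"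
      then have fg: "f \<in> I \<rightarrow>\<^sub>E V" "g \<in> I \<rightarrow>\<^sub>E V" by (simp_all add: constrained_maps_def)
      show "f = g"
      proof (rule PiE_ext[OF fg])
        fix x assume "x \<in> I"
        then have "\<phi> (f x) = \<phi> (g x)" using fun_cong[OF eq, of x] by simp
        then show "f x = g x"
          using fg \<open>x \<in> I\<close> \<phi> by (meson PiE_mem bij_betw_imp_inj_on inj_onD)
      qed
    qed
    show "(\<lambda>f. \<lambda>x\<in>I. \<phi> (f x)) ` constrained_maps I r Q V = constrained_maps I r R W"
    proof (intro equalityI subsetI)
      fix g assume "g \<in> (\<lambda>f. \<lambda>x\<in>I. \<phi> (f x)) ` constrained_maps I r Q V"
      then obtain f where f: "f \<in> constrained_maps I r Q V" and g: "g = (\<lambda>x\<in>I. \<phi> (f x))" by auto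
      have fV: "f x \<in> V" if "x \<in> I" for x
        using f that by (auto simp: constrained_maps_def)
      then have "\<phi> (f x) \<in> W" if "x \<in> I" for x
        using \<phi> that by (auto simp: bij_betw_def)
      moreover have "R x y (\<phi> (f x)) (\<phi> (f y))" if "(x, y) \<in> r" "x \<noteq> y" for x y
        using that f mem[OF that(1)] fV by (simp add: Q constrained_maps_def)
      ultimately show "g \<in> constrained_maps I r R W"
        by (simp add: g restrict_in_constrained_maps_iff[OF r])
    next
      fix g assume g: "g \<in> constrained_maps I r R W"
      define f where "f = (\<lambda>x\<in>I. inv_into V \<phi> (g x))"
      have gW: "g x \<in> \<phi> ` V" if "x \<in> I" for x
        using g that \<phi> by (auto simp: constrained_maps_def bij_betw_def)
      have fV: "f x \<in> V" and \<phi>f: "\<phi> (f x) = g x" if "x \<in> I" for x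
        using gW[OF that] that by (simp_all add: f_def inv_into_into f_inv_into_f)
      have "f \<in> I \<rightarrow>\<^sub>E V"
        using fV by (intro PiE_I) (simp_all add: f_def)
      moreover have "Q x y (f x) (f y)" if "(x, y) \<in> r" "x \<noteq> y" for x y
        using that g mem[OF that(1)] fV \<phi>f Q[of x y "f x" "f y"] by (simp add: constrained_maps_def)
      ultimately have "f \<in> constrained_maps I r Q V"
        by (simp add: constrained_maps_def)
      moreover have "(\<lambda>x\<in>I. \<phi> (f x)) = g"
        using g \<phi>f by (intro extensionalityI[of _ I]) (auto simp: constrained_maps_def PiE_def)
      ultimately show "g \<in> (\<lambda>f. \<lambda>x\<in>I. \<phi> (f x)) ` constrained_maps I r Q V"
        by blast
    qed
  qed
qed

text \<open>
  The conditions on a pair \<open>x \<prec> y\<close> whose values have ranks \<open>a\<close> and \<open>b\<close>; even ranks belong to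
  negative values.
\<close>

definition rank_compat :: "nat \<Rightarrow> nat \<Rightarrow> nat \<Rightarrow> nat \<Rightarrow> bool"
  where "rank_compat x y a b \<longleftrightarrow>
    a \<le> b \<and> (a = b \<longrightarrow> (if even a then y < x else x < y))"

abbreviation rank_partitions :: "nat \<Rightarrow> (nat \<times> nat) set \<Rightarrow> nat \<Rightarrow> nat \<Rightarrow> (nat \<Rightarrow> nat) set"
  where "rank_partitions p r l u \<equiv> constrained_maps {1..p} r rank_compat {l..<u}"

text \<open>
  A rank of the parity at which equality is forbidden needs \<open>a + 1 \<le> b\<close>. This is the form
  \<open>h a \<le> b\<close> with \<open>h\<close> monotone, from which closure under maxima and minima is immediate.
\<close>

lemma rank_compat_iff_le:
  assumes "x \<noteq> y"
  shows "rank_compat x y a b \<longleftrightarrow> a + of_bool (even a \<longleftrightarrow> x < y) \<le> b"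
  using assms by (cases "a = b") (auto simp: rank_compat_def of_bool_def)

lemma mono_add_of_bool_even: "mono (\<lambda>a::nat. a + of_bool (even a \<longleftrightarrow> c))"
proof (rule monoI)
  fix a b :: nat assume "a \<le> b"
  then show "a + of_bool (even a \<longleftrightarrow> c) \<le> b + of_bool (even b \<longleftrightarrow> c)"
    by (cases "a = b") (auto simp: of_bool_def)
qed

lemma rank_compat_max_min:
  assumes "x \<noteq> y" "rank_compat x y a b" "rank_compat x y a' b'"
  shows "rank_compat x y (max a a') (max b b')" "rank_compat x y (min a a') (min b b')"
  using assms(2,3) max_of_mono[OF mono_add_of_bool_even[of "x < y"], of a a']
    min_of_mono[OF mono_add_of_bool_even[of "x < y"], of a a']
  unfolding rank_compat_iff_le[OF assms(1)] by (metis max.mono, metis min.mono)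

lemma max_min_in_rank_partitions:
  assumes r: "r \<subseteq> {1..p} \<times> {1..p}"
    and f: "f \<in> rank_partitions p r l u" and g: "g \<in> rank_partitions p r l' u'"
  shows "(\<lambda>x\<in>{1..p}. max (f x) (g x)) \<in> rank_partitions p r (max l l') (max u u')"
    and "(\<lambda>x\<in>{1..p}. min (f x) (g x)) \<in> rank_partitions p r (min l l') (min u u')"
proof -
  have "f x \<in> {l..<u}" "g x \<in> {l'..<u'}" if "x \<in> {1..p}" for x
    using f g that unfolding constrained_maps_def by (blast dest: PiE_mem)+
  then have range: "max (f x) (g x) \<in> {max l l'..<max u u'}" "min (f x) (g x) \<in> {min l l'..<min u u'}"
    if "x \<in> {1..p}" for x
    using that by (force simp: max_def min_def)+
  have compat: "rank_compat x y (max (f x) (g x)) (max (f y) (g y))"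
    "rank_compat x y (min (f x) (g x)) (min (f y) (g y))" if "(x, y) \<in> r" "x \<noteq> y" for x y
    using that f g by (auto simp: constrained_maps_def intro!: rank_compat_max_min)
  show "(\<lambda>x\<in>{1..p}. max (f x) (g x)) \<in> rank_partitions p r (max l l') (max u u')"
    "(\<lambda>x\<in>{1..p}. min (f x) (g x)) \<in> rank_partitions p r (min l l') (min u u')"
    unfolding restrict_in_constrained_maps_iff[OF r] using range compat by blast+
qed

text \<open>A shift by \<open>2\<close> preserves parity; a shift by \<open>1\<close> would exchange the two signs.\<close>

lemma card_rank_partitions_shift:
  assumes "r \<subseteq> {1..p} \<times> {1..p}"
  shows "card (rank_partitions p r l u) = card (rank_partitions p r (l + 2) (u + 2))"
  using assms
proof (rule card_constrained_maps_cong)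
  show "bij_betw (\<lambda>a. a + 2) {l..<u} {l + 2..<u + 2}"
    by (rule bij_betw_byWitness[where f' = "\<lambda>a. a - 2"]) auto
qed (simp add: rank_compat_def)

definition rank :: "int \<Rightarrow> nat"
  where "rank k = (if k > 0 then 2 * nat k - 1 else 2 * nat (- k) - 2)"

lemma bij_betw_rank: "bij_betw rank (enr_range n) {0..<2 * n}"
proof (rule bij_betw_byWitness[where
      f' = "\<lambda>a. if even a then - int (a div 2) - 1 else int (a div 2) + 1"])
  show "\<forall>k\<in>enr_range n.
      (if even (rank k) then - int (rank k div 2) - 1 else int (rank k div 2) + 1) = k"
  proof
    fix k :: int assume k: "k \<in> enr_range n"
    show "(if even (rank k) then - int (rank k div 2) - 1 else int (rank k div 2) + 1) = k"
    proof (cases "k > 0")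
      case True
      then have "rank k = 2 * nat (k - 1) + 1" by (simp add: rank_def)
      with True show ?thesis by simp
    next
      case False
      then have "rank k = 2 * nat (- k - 1)" "k < 0" using k by (auto simp: rank_def enr_range_def)
      then show ?thesis by simp
    qed
  qed
qed (auto simp: rank_def enr_range_def elim!: evenE oddE)

lemma rank_compat_rank:
  assumes "x \<noteq> y" "a \<noteq> 0" "b \<noteq> 0"
  shows "rank_compat x y (rank a) (rank b) \<longleftrightarrow>
    a \<unlhd>\<^sub>e b \<and> (a = b \<and> b > 0 \<longrightarrow> x < y) \<and> (a = b \<and> b < 0 \<longrightarrow> x > y)"
proof -
  have le: "rank a \<le> rank b \<longleftrightarrow> a \<unlhd>\<^sub>e b"
    using assms(2,3) by (cases "a > 0"; cases "b > 0") (auto simp: rank_def enr_le_def)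
  have eq: "rank a = rank b \<longleftrightarrow> a = b"
    by (rule inj_on_eq_iff[OF bij_betw_imp_inj_on[OF bij_betw_rank[of "nat \<bar>a\<bar> + nat \<bar>b\<bar>"]]])
      (use assms(2,3) in \<open>simp_all add: enr_range_def\<close>)
  have even: "even (rank b) \<longleftrightarrow> b < 0"
    using assms(3) by (auto simp: rank_def)
  show ?thesis
    using assms(3) by (auto simp: rank_compat_def le eq even)
qed

lemma enriched_order_poly_eq_card_rank_partitions:
  assumes "r \<subseteq> {1..p} \<times> {1..p}"
  shows "enriched_order_poly p r n = card (rank_partitions p r 0 (2 * n))"
proof -
  have "card (rank_partitions p r 0 (2 * n)) = card (constrained_maps {1..p} r
      (\<lambda>x y a b. a \<unlhd>\<^sub>e b \<and> (a = b \<and> b > 0 \<longrightarrow> x < y) \<and> (a = b \<and> b < 0 \<longrightarrow> x > y)) (enr_range n))"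
    using assms bij_betw_rank
    by (rule card_constrained_maps_cong[symmetric]) (auto simp: rank_compat_rank enr_range_def)
  then show ?thesis
    by (simp add: enriched_order_poly_def enriched_P_partitions_def constrained_maps_def)
qed

section \<open>Log-concavity\<close>

theorem theorem4p5:
  fixes p :: nat and r :: "(nat \<times> nat) set"
  assumes "partial_order_on {1..p} r"
  shows "\<forall>n\<ge>1. (enriched_order_poly p r n)\<^sup>2
           \<ge> enriched_order_poly p r (n - 1) * enriched_order_poly p r (n + 1)"
proof (intro allI impI)
  fix n :: nat assume "n \<ge> 1"
  have r: "r \<subseteq> {1..p} \<times> {1..p}"
    using assms by (auto simp: partial_order_on_def preorder_on_def)
  let ?F = "rank_partitions p r"
  have sub: "?F l u \<subseteq> {1..p} \<rightarrow>\<^sub>E {..2 * n + 2}" if "u \<le> 2 * n + 2" for l u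
  proof -
    have "{1..p} \<rightarrow>\<^sub>E {l..<u} \<subseteq> {1..p} \<rightarrow>\<^sub>E {..2 * n + 2}"
      by (rule PiE_mono) (use that in auto)
    then show ?thesis unfolding constrained_maps_def by blast
  qed
  have "2 * (n - 1) + 2 = 2 * n"
    using \<open>n \<ge> 1\<close> by simp
  then have "enriched_order_poly p r (n - 1) * enriched_order_poly p r (n + 1)
      = card (?F 2 (2 * n)) * card (?F 0 (2 * n + 2))"
    using card_rank_partitions_shift[OF r, of 0 "2 * (n - 1)"]
    by (simp only: enriched_order_poly_eq_card_rank_partitions[OF r] add_0 distrib_left mult_1_right)
  also have "\<dots> \<le> card (?F 2 (2 * n + 2)) * card (?F 0 (2 * n))"
  proof (rule card_mult_card_le_max_min[where I = "{1..p}" and m = "2 * n + 2"])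
    fix f g assume "f \<in> ?F 2 (2 * n)" "g \<in> ?F 0 (2 * n + 2)"
    from max_min_in_rank_partitions[OF r this]
    show "(\<lambda>x\<in>{1..p}. max (f x) (g x)) \<in> ?F 2 (2 * n + 2)
        \<and> (\<lambda>x\<in>{1..p}. min (f x) (g x)) \<in> ?F 0 (2 * n)"
      by simp
  qed (simp, (rule sub, simp)+)
  also have "\<dots> = (enriched_order_poly p r n)\<^sup>2"
    using card_rank_partitions_shift[OF r, of 0 "2 * n"]
    by (simp only: enriched_order_poly_eq_card_rank_partitions[OF r] power2_eq_square add_0)
  finally show "enriched_order_poly p r (n - 1) * enriched_order_poly p r (n + 1)
      \<le> (enriched_order_poly p r n)\<^sup>2" .
qed

end
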